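(* Let $k\ge 1$ be an integer and let $n=m^2$ for a positive integer $m$ such that $t=\frac{\sqrt{n}}{k}-1$ is a nonnegative integer. Set $T=\sqrt{n}/k$. Then for every sufficiently large $P>1$, the vector $(y^n_I)_{I\subseteq[n]}$ defined by $y^n_I=\alpha$ for every $I\subseteq[n]$ with $|I|\le t+1$ and $y^n_I=0$ otherwise, where $\alpha>0$ is chosen so that $\sum_{I\subseteq[n]}y^n_I=1$, is feasible for $\mathrm{Las}_t(LP(T))$.
   Context: Scheduling instance: $n=m^2$ unit-cost jobs partitioned into blocks $N_1,\dots,N_m$ of $m$ jobs each; the jobs of block $N_i$ have processing time $P^i$ (with $P>1$), and the demand at the deadline of block $i$ is $D_i=\sum_{j=1}^{i}P^{j-1}$. Variables $x_{ij}$, $i,j\in[m]$, are identified with the elements of $[n]$ via $(i,j)\mapsto (i-1)m+j$. $LP(T)$ consists of the linear constraints $g_0(x)=T-\sum_{i=1}^m\sum_{j=1}^m x_{ij}\ge 0$ and, for each $\ell\in[m]$, $g_\ell(x)=\sum_{i=1}^{\ell}\sum_{j=1}^m P^i x_{ij}-D_\ell\ge 0$. For $I\subseteq[n]$, $x_I\in\{0,1\}^n$ denotes the indicator vector of $I$ ($x_i=1$ iff $i\in I$). For an integer $d\ge 0$, $\mathcal{P}_d(n)$ is the family of subsets of $[n]$ of size at most $d$, and for $I\subseteq[n]$ the zeta vector $Z_I\in\mathbb{R}^{\mathcal{P}_d(n)}$ has entries $[Z_I]_J=1$ if $J\subseteq I$ and $0$ otherwise. The Lasserre relaxation $\mathrm{Las}_t(LP(T))$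 at level $t$ is the set of real vectors $(y^n_I)_{I\subseteq[n]}$ satisfying: (i) $\sum_{I\subseteq[n]}y^n_I=1$; (ii) $\sum_{I\subseteq[n]}y^n_I Z_IZ_I^\top\succeq 0$ with $Z_I\in\mathbb{R}^{\mathcal{P}_{t+1}(n)}$; (iii) for each constraint $g\in\{g_0,g_1,\dots,g_m\}$, $\sum_{I\subseteq[n]}g(x_I)\,y^n_I Z_IZ_I^\top\succeq 0$ with $Z_I\in\mathbb{R}^{\mathcal{P}_{t}(n)}$. Here $\succeq 0$ means positive semidefinite. *)

theory Defs
  imports Complex_Main "HOL-Library.Indicator_Function"
begin

text \<open>A real matrix with rows and columns indexed by a finite set \<open>S\<close> is a function of two
  arguments, of which only the values on \<open>S\<close> matter.\<close>

definition psd_on :: "'a set \<Rightarrow> ('a \<Rightarrow> 'a \<Rightarrow> real) \<Rightarrow> bool" where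
  "psd_on S M \<longleftrightarrow>
     (\<forall>a\<in>S. \<forall>b\<in>S. M a b = M b a) \<and>
     (\<forall>v. (\<Sum>a\<in>S. \<Sum>b\<in>S. v a * M a b * v b) \<ge> 0)"

definition subsets_upto :: "nat \<Rightarrow> nat \<Rightarrow> nat set set" where
  "subsets_upto d n = {J. J \<subseteq> {1..n} \<and> card J \<le> d}"

definition zeta_vec :: "nat set \<Rightarrow> nat set \<Rightarrow> real" where
  "zeta_vec I J = (if J \<subseteq> I then 1 else 0)"

text \<open>The matrix \<open>\<Sum>\<^sub>I w\<^sub>I Z\<^sub>I Z\<^sub>I\<^sup>T\<close>; its size is determined by the index set handed to
  \<^const>\<open>psd_on\<close>.\<close>

definition zeta_matrix :: "nat \<Rightarrow> (nat set \<Rightarrow> real) \<Rightarrow> nat set \<Rightarrow> nat set \<Rightarrow> real" where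
  "zeta_matrix n w A B = (\<Sum>I\<in>Pow {1..n}. w I * (zeta_vec I A * zeta_vec I B))"

text \<open>A point of \<open>\<real>\<^sup>n\<close> is a function \<open>x :: nat \<Rightarrow> real\<close> of which only the values on \<open>{1..n}\<close> matter,
  a constraint \<open>g(x) \<ge> 0\<close> is represented by the function \<open>g\<close>, and a relaxation by the set of its
  constraints. The point \<open>x\<^sub>I\<close> is \<open>indicator I\<close>. A vector \<open>(y\<^sub>I)\<close> is a function on sets of which
  only the values on \<open>Pow {1..n}\<close> matter.\<close>

definition Las :: "nat \<Rightarrow> nat \<Rightarrow> ((nat \<Rightarrow> real) \<Rightarrow> real) set \<Rightarrow> (nat set \<Rightarrow> real) set" where
  "Las n t G =
     {y. (\<Sum>I\<in>Pow {1..n}. y I) = 1 \<and>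
         psd_on (subsets_upto (t + 1) n) (zeta_matrix n y) \<and>
         (\<forall>g\<in>G. psd_on (subsets_upto t n) (zeta_matrix n (\<lambda>I. g (indicator I) * y I)))}"

definition var_index :: "nat \<Rightarrow> nat \<Rightarrow> nat \<Rightarrow> nat" where
  "var_index m i j = (i - 1) * m + j"

definition demand :: "real \<Rightarrow> nat \<Rightarrow> real" where
  "demand P i = (\<Sum>j=1..i. P ^ (j - 1))"

definition g_cost :: "nat \<Rightarrow> real \<Rightarrow> (nat \<Rightarrow> real) \<Rightarrow> real" where
  "g_cost m T x = T - (\<Sum>i=1..m. \<Sum>j=1..m. x (var_index m i j))"

definition g_demand :: "nat \<Rightarrow> real \<Rightarrow> nat \<Rightarrow> (nat \<Rightarrow> real) \<Rightarrow> real" where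
  "g_demand m P l x = (\<Sum>i=1..l. \<Sum>j=1..m. P ^ i * x (var_index m i j)) - demand P l"

definition LP :: "nat \<Rightarrow> real \<Rightarrow> real \<Rightarrow> ((nat \<Rightarrow> real) \<Rightarrow> real) set" where
  "LP m P T = insert (g_cost m T) (g_demand m P ` {1..m})"

definition y_vec :: "nat \<Rightarrow> nat \<Rightarrow> real \<Rightarrow> nat set \<Rightarrow> real" where
  "y_vec n t \<alpha> I = (if I \<subseteq> {1..n} \<and> card I \<le> t + 1 then \<alpha> else 0)"

lemma y_vec_normalised_ex1: "\<exists>!\<alpha>. \<alpha> > 0 \<and> (\<Sum>I\<in>Pow {1..n}. y_vec n t \<alpha> I) = 1"
proof -
  let ?C = "subsets_upto (t + 1) n"
  have C: "?C \<subseteq> Pow {1..n}" by (auto simp: subsets_upto_def)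
  then have fin: "finite ?C" by (rule finite_subset) simp
  have "{} \<in> ?C" by (simp add: subsets_upto_def)
  with fin have pos: "card ?C > 0" by (auto simp: card_gt_0_iff)
  have "(\<Sum>I\<in>Pow {1..n}. y_vec n t \<alpha> I) = (\<Sum>I\<in>?C. \<alpha>)" for \<alpha>
    by (rule sum.mono_neutral_cong_right) (use C in \<open>auto simp: y_vec_def subsets_upto_def\<close>)
  then have *: "(\<Sum>I\<in>Pow {1..n}. y_vec n t \<alpha> I) = real (card ?C) * \<alpha>" for \<alpha>
    by simp
  show ?thesis
    unfolding * by (rule ex1I[of _ "1 / real (card ?C)"]) (use pos in \<open>auto simp: field_simps\<close>)
qed

end

theory Submission imports Defs "HOL-Analysis.Convex" begin

text \<open>The quadratic form of \<open>\<Sum>\<^sub>I w\<^sub>I Z\<^sub>I Z\<^sub>I\<^sup>T\<close> at \<open>v\<close> is \<open>\<Sum>\<^sub>I w\<^sub>I p(I)\<^sup>2\<close>, where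
  \<open>p(I) = \<Sum>\<^sub>J v\<^sub>J [J \<subseteq> I]\<close> is a multilinear polynomial of degree at most \<open>t\<close>. Negative weights
  occur only in the demand constraints. Let \<open>B\<close> consist of \<open>t + 1\<close> elements of the last block of
  such a constraint. The weight is positive at sets meeting \<open>B\<close>, and larger by a factor of order
  \<open>P\<close> than the possibly negative weights at sets missing \<open>B\<close>. It therefore suffices to bound
  \<open>p(I)\<^sup>2\<close>, for \<open>I\<close> missing \<open>B\<close> and \<open>|I| \<le> t + 1\<close>, by a multiple, independent of \<open>P\<close>, of the sum
  of all \<open>p(K)\<^sup>2\<close> with \<open>K\<close> meeting \<open>B\<close> and \<open>|K| \<le> t + 1\<close>. Fix an injection of \<open>I\<close> into \<open>B\<close>, and for
  \<open>Z \<subseteq> B\<close> let \<open>I\<^sub>Z\<close> arise from \<open>I\<close> by adding \<open>Z\<close> and deleting the preimages of its elements. As a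
  function of \<open>Z\<close>, \<open>p(I\<^sub>Z)\<close> has degree at most \<open>t < |B|\<close>, so its alternating sum over all \<open>Z \<subseteq> B\<close>
  vanishes; the term \<open>Z = {}\<close> is \<open>p(I)\<close>, all the others are of the form \<open>p(K)\<close>.\<close>

lemma alternating_sum_Pow_eq_0:
  fixes f :: "'a set \<Rightarrow> 'b::ring_1"
  assumes "finite B" "b \<in> B"
    and insert_invariant: "\<And>Z. Z \<subseteq> B \<Longrightarrow> b \<notin> Z \<Longrightarrow> f (insert b Z) = f Z"
  shows "(\<Sum>Z\<in>Pow B. (-1) ^ card Z * f Z) = 0"
proof -
  let ?C = "B - {b}"
  have "inj_on (insert b) (Pow ?C)"
    by (rule inj_on_inverseI[where g = "\<lambda>Z. Z - {b}"]) auto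
  have "Pow B = Pow ?C \<union> insert b ` Pow ?C"
    using \<open>b \<in> B\<close> Pow_insert[of b ?C] by (simp add: insert_absorb)
  then have "(\<Sum>Z\<in>Pow B. (-1) ^ card Z * f Z) =
      (\<Sum>Z\<in>Pow ?C. (-1) ^ card Z * f Z) + (\<Sum>Z\<in>insert b ` Pow ?C. (-1) ^ card Z * f Z)"
    using \<open>finite B\<close> by (auto intro!: sum.union_disjoint)
  also have "(\<Sum>Z\<in>insert b ` Pow ?C. (-1) ^ card Z * f Z) =
      (\<Sum>Z\<in>Pow ?C. (-1) ^ card (insert b Z) * f (insert b Z))"
    using \<open>inj_on (insert b) (Pow ?C)\<close> by (simp add: sum.reindex)
  also have "\<dots> = (\<Sum>Z\<in>Pow ?C. - ((-1) ^ card Z * f Z))"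
  proof (rule sum.cong)
    fix Z assume "Z \<in> Pow ?C"
    then have "Z \<subseteq> B" "b \<notin> Z" "finite Z"
      using \<open>finite B\<close> by (auto intro: finite_subset)
    then show "(-1) ^ card (insert b Z) * f (insert b Z) = - ((-1) ^ card Z * f Z)"
      by (simp add: insert_invariant)
  qed simp
  finally show ?thesis by (simp add: sum_negf)
qed

definition zeta_poly :: "nat set set \<Rightarrow> (nat set \<Rightarrow> real) \<Rightarrow> nat set \<Rightarrow> real" where
  "zeta_poly S v I = (\<Sum>J\<in>S. v J * zeta_vec I J)"

lemma zeta_matrix_quadratic_form:
  "(\<Sum>A\<in>S. \<Sum>B\<in>S. v A * zeta_matrix n w A B * v B) = (\<Sum>I\<in>Pow {1..n}. w I * (zeta_poly S v I)\<^sup>2)"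
proof -
  let ?term = "\<lambda>A B I. w I * ((v A * zeta_vec I A) * (v B * zeta_vec I B))"
  have "(\<Sum>A\<in>S. \<Sum>B\<in>S. v A * zeta_matrix n w A B * v B) =
      (\<Sum>A\<in>S. \<Sum>B\<in>S. \<Sum>I\<in>Pow {1..n}. ?term A B I)"
    unfolding zeta_matrix_def sum_distrib_left sum_distrib_right
    by (intro sum.cong refl) (simp add: mult_ac)
  also have "\<dots> = (\<Sum>A\<in>S. \<Sum>I\<in>Pow {1..n}. \<Sum>B\<in>S. ?term A B I)"
    by (intro sum.cong refl sum.swap)
  also have "\<dots> = (\<Sum>I\<in>Pow {1..n}. \<Sum>A\<in>S. \<Sum>B\<in>S. ?term A B I)"
    by (rule sum.swap)
  also have "\<dots> = (\<Sum>I\<in>Pow {1..n}. w I * (zeta_poly S v I)\<^sup>2)"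
    unfolding zeta_poly_def power2_eq_square sum_product unfolding sum_distrib_left ..
  finally show ?thesis .
qed

lemma psd_on_zeta_matrix_iff:
  "psd_on S (zeta_matrix n w) \<longleftrightarrow> (\<forall>v. (\<Sum>I\<in>Pow {1..n}. w I * (zeta_poly S v I)\<^sup>2) \<ge> 0)"
  unfolding psd_on_def zeta_matrix_quadratic_form by (auto simp: zeta_matrix_def mult_ac)

lemma psd_on_zeta_matrix_nonneg:
  assumes "\<And>I. I \<subseteq> {1..n} \<Longrightarrow> w I \<ge> 0"
  shows "psd_on S (zeta_matrix n w)"
  unfolding psd_on_zeta_matrix_iff using assms by (intro allI sum_nonneg mult_nonneg_nonneg) auto

definition exchange :: "('a \<Rightarrow> 'a) \<Rightarrow> 'a set \<Rightarrow> 'a set \<Rightarrow> 'a set" where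
  "exchange f I Z = Z \<union> {a \<in> I. f a \<notin> Z}"

lemma exchange_empty [simp]: "exchange f I {} = I"
  by (simp add: exchange_def)

lemma exchange_Int:
  assumes "Z \<subseteq> B" "I \<inter> B = {}"
  shows "exchange f I Z \<inter> B = Z"
  using assms by (auto simp: exchange_def)

lemma card_exchange_le:
  assumes "finite B" "Z \<subseteq> B" "f ` I \<subseteq> B" "inj_on f I"
  shows "card (exchange f I Z) \<le> card B"
proof -
  have "card {a \<in> I. f a \<notin> Z} \<le> card (B - Z)"
    using assms by (intro card_inj_on_le[of f]) (auto intro: inj_on_subset)
  also have "\<dots> = card B - card Z"
    using assms by (intro card_Diff_subset) (auto intro: finite_subset)
  finally have "card Z + card {a \<in> I. f a \<notin> Z} \<le> card B"
    using card_mono[OF \<open>finite B\<close> \<open>Z \<subseteq> B\<close>] by linarith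
  then show ?thesis
    using card_Un_le[of Z "{a \<in> I. f a \<notin> Z}"] unfolding exchange_def by linarith
qed

lemma alternating_sum_zeta_vec_exchange:
  assumes "finite B" "I \<inter> B = {}" "finite J" "card J < card B"
  shows "(\<Sum>Z\<in>Pow B. (-1) ^ card Z * zeta_vec (exchange f I Z) J) = 0"
proof -
  let ?T = "(J - I) \<union> f ` (J \<inter> I)"
  have "card ?T \<le> card (J - I) + card (f ` (J \<inter> I))"
    by (rule card_Un_le)
  also have "\<dots> \<le> card (J - I) + card (J \<inter> I)"
    using \<open>finite J\<close> by (simp add: card_image_le)
  also have "\<dots> = card J"
    using card_Int_Diff[OF \<open>finite J\<close>, of I] by simp
  finally have "\<not> B \<subseteq> ?T"
    using card_mono[of ?T B] \<open>finite J\<close> \<open>card J < card B\<close> by auto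
  then obtain b where "b \<in> B" "b \<notin> ?T" by blast
  show ?thesis
  proof (rule alternating_sum_Pow_eq_0[OF \<open>finite B\<close> \<open>b \<in> B\<close>])
    fix Z
    have "J \<subseteq> exchange f I (insert b Z) \<longleftrightarrow> J \<subseteq> exchange f I Z"
      using \<open>b \<in> B\<close> \<open>b \<notin> ?T\<close> \<open>I \<inter> B = {}\<close> unfolding exchange_def by blast
    then show "zeta_vec (exchange f I (insert b Z)) J = zeta_vec (exchange f I Z) J"
      by (simp add: zeta_vec_def)
  qed
qed

lemma alternating_sum_zeta_poly_exchange:
  assumes "finite B" "I \<inter> B = {}"
    and "\<And>J. J \<in> S \<Longrightarrow> finite J \<and> card J < card B"
  shows "(\<Sum>Z\<in>Pow B. (-1) ^ card Z * zeta_poly S v (exchange f I Z)) = 0"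
proof -
  have "(\<Sum>Z\<in>Pow B. (-1) ^ card Z * zeta_poly S v (exchange f I Z)) =
      (\<Sum>J\<in>S. v J * (\<Sum>Z\<in>Pow B. (-1) ^ card Z * zeta_vec (exchange f I Z) J))"
    unfolding zeta_poly_def sum_distrib_left by (subst sum.swap) (simp add: mult_ac)
  also have "\<dots> = 0"
    using assms by (simp add: alternating_sum_zeta_vec_exchange)
  finally show ?thesis .
qed

lemma zeta_poly_square_le_exchange:
  assumes "finite B" "I \<inter> B = {}"
    and "\<And>J. J \<in> S \<Longrightarrow> finite J \<and> card J < card B"
  shows "(zeta_poly S v I)\<^sup>2 \<le>
    2 ^ card B * (\<Sum>Z\<in>Pow B - {{}}. (zeta_poly S v (exchange f I Z))\<^sup>2)"
proof -
  let ?p = "\<lambda>Z. zeta_poly S v (exchange f I Z)" and ?Zs = "Pow B - {{}}"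
  have "?p {} + (\<Sum>Z\<in>?Zs. (-1) ^ card Z * ?p Z) = 0"
    using alternating_sum_zeta_poly_exchange[OF assms, where v = v and f = f]
      sum.remove[of "Pow B" "{}" "\<lambda>Z. (-1) ^ card Z * ?p Z"] \<open>finite B\<close> by simp
  then have "zeta_poly S v I = - (\<Sum>Z\<in>?Zs. (-1) ^ card Z * ?p Z)"
    by (simp add: eq_neg_iff_add_eq_0)
  then have "(zeta_poly S v I)\<^sup>2 = (\<Sum>Z\<in>?Zs. (-1) ^ card Z * ?p Z)\<^sup>2"
    by simp
  also have "\<dots> \<le> (\<Sum>Z\<in>?Zs. ((-1) ^ card Z * ?p Z)\<^sup>2) * card ?Zs"
    by (rule sum_squared_le_sum_of_squares)
  also have "\<dots> = card ?Zs * (\<Sum>Z\<in>?Zs. (?p Z)\<^sup>2)"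
    by (simp add: power_mult_distrib flip: power_mult)
  also have "\<dots> \<le> 2 ^ card B * (\<Sum>Z\<in>?Zs. (?p Z)\<^sup>2)"
  proof (rule mult_right_mono)
    have "card ?Zs \<le> card (Pow B)"
      using \<open>finite B\<close> by (intro card_mono) auto
    then show "real (card ?Zs) \<le> 2 ^ card B"
      using \<open>finite B\<close> by (simp add: card_Pow)
  qed (simp add: sum_nonneg)
  finally show ?thesis .
qed

lemma zeta_poly_square_le:
  assumes "finite B" "finite I" "I \<inter> B = {}" "card I \<le> card B"
    and "\<And>J. J \<in> S \<Longrightarrow> finite J \<and> card J < card B"
  shows "(zeta_poly S v I)\<^sup>2 \<le>
    2 ^ card B * (\<Sum>K | K \<subseteq> I \<union> B \<and> card K \<le> card B \<and> K \<inter> B \<noteq> {}. (zeta_poly S v K)\<^sup>2)"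
proof -
  let ?M = "{K. K \<subseteq> I \<union> B \<and> card K \<le> card B \<and> K \<inter> B \<noteq> {}}" and ?Zs = "Pow B - {{}}"
  obtain f where inj_into_B: "f ` I \<subseteq> B" "inj_on f I"
    using card_le_inj[OF \<open>finite I\<close> \<open>finite B\<close> \<open>card I \<le> card B\<close>] by blast
  have "inj_on (exchange f I) ?Zs"
    using \<open>I \<inter> B = {}\<close>
    by (intro inj_on_inverseI[where g = "\<lambda>K. K \<inter> B"]) (auto simp: exchange_Int)
  then have "(\<Sum>Z\<in>?Zs. (zeta_poly S v (exchange f I Z))\<^sup>2) =
      (\<Sum>K\<in>exchange f I ` ?Zs. (zeta_poly S v K)\<^sup>2)"
    by (simp add: sum.reindex)
  also have "\<dots> \<le> (\<Sum>K\<in>?M. (zeta_poly S v K)\<^sup>2)"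
  proof (rule sum_mono2)
    show "exchange f I ` ?Zs \<subseteq> ?M"
    proof (rule image_subsetI)
      fix Z assume "Z \<in> ?Zs"
      moreover have "exchange f I Z \<subseteq> I \<union> Z" by (auto simp: exchange_def)
      ultimately show "exchange f I Z \<in> ?M"
        using exchange_Int[of Z B I f] card_exchange_le[of B Z f I] inj_into_B assms(1,3) by auto
    qed
  qed (use assms(1,2) in auto)
  finally have "2 ^ card B * (\<Sum>Z\<in>?Zs. (zeta_poly S v (exchange f I Z))\<^sup>2) \<le>
      2 ^ card B * (\<Sum>K\<in>?M. (zeta_poly S v K)\<^sup>2)"
    by (rule mult_left_mono) simp
  with zeta_poly_square_le_exchange[OF assms(1,3,5)] show ?thesis
    by (rule order_trans)
qed

lemma finite_subsets_upto [simp]: "finite (subsets_upto d n)"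
  by (rule finite_subset[of _ "Pow {1..n}"]) (auto simp: subsets_upto_def)

lemma card_subsets_upto_le: "card (subsets_upto d n) \<le> 2 ^ n"
  using card_mono[of "Pow {1..n}" "subsets_upto d n"] by (auto simp: card_Pow subsets_upto_def)

lemma sum_zeta_poly_square_le:
  assumes "B \<subseteq> {1..n}"
    and "\<And>J. J \<in> S \<Longrightarrow> finite J \<and> card J < card B"
  shows "(\<Sum>I | I \<in> subsets_upto (card B) n \<and> I \<inter> B = {}. (zeta_poly S v I)\<^sup>2) \<le>
    2 ^ (n + card B) * (\<Sum>K | K \<in> subsets_upto (card B) n \<and> K \<inter> B \<noteq> {}. (zeta_poly S v K)\<^sup>2)"
    (is "(\<Sum>I\<in>?missing. _) \<le> _ * ?Q")
proof -
  have "finite B" using assms(1) by (rule finite_subset) simp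
  have "(zeta_poly S v I)\<^sup>2 \<le> 2 ^ card B * ?Q" if "I \<in> ?missing" for I
  proof -
    have I_bounds: "I \<subseteq> {1..n}" "card I \<le> card B" "I \<inter> B = {}"
      using that by (auto simp: subsets_upto_def)
    then have "finite I" by (auto intro: finite_subset)
    have "(zeta_poly S v I)\<^sup>2 \<le> 2 ^ card B *
        (\<Sum>K | K \<subseteq> I \<union> B \<and> card K \<le> card B \<and> K \<inter> B \<noteq> {}. (zeta_poly S v K)\<^sup>2)"
      using \<open>finite B\<close> \<open>finite I\<close> I_bounds(3,2) assms(2) by (rule zeta_poly_square_le)
    also have "\<dots> \<le> 2 ^ card B * ?Q"
      using I_bounds(1) assms(1) by (intro mult_left_mono sum_mono2) (auto simp: subsets_upto_def)
    finally show ?thesis .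
  qed
  then have "(\<Sum>I\<in>?missing. (zeta_poly S v I)\<^sup>2) \<le> real (card ?missing) * (2 ^ card B * ?Q)"
    by (rule sum_bounded_above)
  also have "\<dots> \<le> 2 ^ n * (2 ^ card B * ?Q)"
  proof (rule mult_right_mono)
    have "card ?missing \<le> card (subsets_upto (card B) n)"
      by (rule card_mono) auto
    also have "\<dots> \<le> 2 ^ n" by (rule card_subsets_upto_le)
    finally show "real (card ?missing) \<le> 2 ^ n" by simp
  qed (simp add: sum_nonneg)
  finally show ?thesis by (simp add: power_add mult_ac)
qed

lemma psd_on_zeta_matrix_dominated:
  assumes "B \<subseteq> {1..n}" "b \<ge> 0"
    and small: "\<And>J. J \<in> S \<Longrightarrow> finite J \<and> card J < card B"
    and support: "\<And>I. I \<subseteq> {1..n} \<Longrightarrow> w I \<noteq> 0 \<Longrightarrow> card I \<le> card B"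
    and meeting: "\<And>I. I \<in> subsets_upto (card B) n \<Longrightarrow> I \<inter> B \<noteq> {} \<Longrightarrow> w I \<ge> 2 ^ (n + card B) * b"
    and missing: "\<And>I. I \<in> subsets_upto (card B) n \<Longrightarrow> I \<inter> B = {} \<Longrightarrow> w I \<ge> - b"
  shows "psd_on S (zeta_matrix n w)"
  unfolding psd_on_zeta_matrix_iff
proof
  fix v
  let ?sq = "\<lambda>I. (zeta_poly S v I)\<^sup>2"
  let ?meeting = "{I \<in> subsets_upto (card B) n. I \<inter> B \<noteq> {}}"
  let ?missing = "{I \<in> subsets_upto (card B) n. I \<inter> B = {}}"
  have "0 \<le> b * (2 ^ (n + card B) * (\<Sum>I\<in>?meeting. ?sq I) - (\<Sum>I\<in>?missing. ?sq I))"
    using sum_zeta_poly_square_le[OF assms(1) small, of S v] \<open>b \<ge> 0\<close> by simp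
  also have "\<dots> = (\<Sum>I\<in>?meeting. 2 ^ (n + card B) * b * ?sq I) + (\<Sum>I\<in>?missing. - b * ?sq I)"
    by (simp only: sum_distrib_left[symmetric]) (simp add: algebra_simps)
  also have "\<dots> \<le> (\<Sum>I\<in>?meeting. w I * ?sq I) + (\<Sum>I\<in>?missing. w I * ?sq I)"
    by (intro add_mono sum_mono mult_right_mono meeting missing) auto
  also have "\<dots> = (\<Sum>I\<in>?meeting \<union> ?missing. w I * ?sq I)"
    by (rule sum.union_disjoint[symmetric]) auto
  also have "\<dots> = (\<Sum>I\<in>Pow {1..n}. w I * ?sq I)"
    by (rule sum.mono_neutral_left) (use support in \<open>auto simp: subsets_upto_def\<close>)
  finally show "0 \<le> (\<Sum>I\<in>Pow {1..n}. w I * ?sq I)" .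
qed

lemma psd_on_zeta_matrix_y_vec_dominated:
  assumes "B \<subseteq> {1..n}" "card B = t + 1" "b \<ge> 0" "\<alpha> \<ge> 0"
    and meeting: "\<And>I. I \<in> subsets_upto (t + 1) n \<Longrightarrow> I \<inter> B \<noteq> {} \<Longrightarrow> c I \<ge> 2 ^ (n + (t + 1)) * b"
    and missing: "\<And>I. I \<in> subsets_upto (t + 1) n \<Longrightarrow> I \<inter> B = {} \<Longrightarrow> c I \<ge> - b"
  shows "psd_on (subsets_upto t n) (zeta_matrix n (\<lambda>I. c I * y_vec n t \<alpha> I))"
proof (rule psd_on_zeta_matrix_dominated[where b = "b * \<alpha>"])
  show "0 \<le> b * \<alpha>" using assms by simp
  show "finite J \<and> card J < card B" if "J \<in> subsets_upto t n" for J
    using that assms(2) by (auto simp: subsets_upto_def intro: finite_subset)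
  fix I
  show "card I \<le> card B" if "c I * y_vec n t \<alpha> I \<noteq> 0"
    using that assms(2) by (simp add: y_vec_def split: if_splits)
  assume "I \<in> subsets_upto (card B) n"
  then have I_upto: "I \<in> subsets_upto (t + 1) n" and y_eq: "y_vec n t \<alpha> I = \<alpha>"
    using assms(2) by (simp_all add: y_vec_def subsets_upto_def)
  show "2 ^ (n + card B) * (b * \<alpha>) \<le> c I * y_vec n t \<alpha> I" if "I \<inter> B \<noteq> {}"
    using mult_right_mono[OF meeting[OF I_upto that] \<open>\<alpha> \<ge> 0\<close>] by (simp add: y_eq assms(2) mult_ac)
  show "- (b * \<alpha>) \<le> c I * y_vec n t \<alpha> I" if "I \<inter> B = {}"
    using mult_right_mono[OF missing[OF I_upto that] \<open>\<alpha> \<ge> 0\<close>] by (simp add: y_eq)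
qed (rule assms(1))

lemma sum_var_index: "(\<Sum>i=1..l. \<Sum>j=1..m. x (var_index m i j)) = sum x {1..l * m}"
proof (induction l)
  case (Suc l)
  have "sum x {1..Suc l * m} = sum x {1..l * m} + sum x {l * m + 1..l * m + m}"
    using sum.ub_add_nat[of 1 "l * m" x m] by (simp add: add.commute)
  also have "sum x {l * m + 1..l * m + m} = (\<Sum>j=1..m. x (var_index m (Suc l) j))"
    using sum.shift_bounds_cl_nat_ivl[of x 1 "l * m" m] by (simp add: var_index_def add.commute)
  finally show ?case using Suc.IH by simp
qed simp

lemma inj_var_index: "inj (var_index m i)"
  by (simp add: inj_def var_index_def)

lemma var_index_in_atLeastAtMost:
  assumes "i \<in> {1..l}" "j \<in> {1..m}"
  shows "var_index m i j \<in> {1..l * m}"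
proof -
  have "(i - 1) * m + j \<le> (i - 1) * m + m" using assms by simp
  also have "\<dots> = i * m" using assms by (cases i) auto
  also have "\<dots> \<le> l * m" using assms by simp
  finally show ?thesis using assms by (simp add: var_index_def)
qed

lemma g_cost_indicator:
  assumes "I \<subseteq> {1..m\<^sup>2}"
  shows "g_cost m T (indicator I) = T - real (card I)"
proof -
  have "(\<Sum>i=1..m. \<Sum>j=1..m. indicator I (var_index m i j)) = (\<Sum>a=1..m\<^sup>2. indicator I a :: real)"
    by (simp only: sum_var_index power2_eq_square)
  also have "\<dots> = (\<Sum>a\<in>I. 1)"
    by (rule sum.mono_neutral_cong_right) (use assms in auto)
  finally show ?thesis by (simp add: g_cost_def)
qed

lemma demand_le:
  assumes "P \<ge> 1"
  shows "demand P l \<le> real l * P ^ (l - 1)"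
proof -
  have "demand P l \<le> (\<Sum>j=1..l. P ^ (l - 1))"
    unfolding demand_def by (intro sum_mono power_increasing) (use assms in auto)
  then show ?thesis by simp
qed

lemma g_demand_ge:
  assumes "P \<ge> 1" "l \<ge> 1" "\<And>a. x a \<ge> 0"
  shows "g_demand m P l x \<ge> (P * (\<Sum>j=1..m. x (var_index m l j)) - real l) * P ^ (l - 1)"
proof -
  have "(\<Sum>j=1..m. P ^ l * x (var_index m l j)) \<le>
      (\<Sum>i=1..l. \<Sum>j=1..m. P ^ i * x (var_index m i j))"
    using assms by (intro member_le_sum) (auto intro!: sum_nonneg)
  moreover have "P ^ l = P * P ^ (l - 1)"
    using \<open>l \<ge> 1\<close> by (simp flip: power_Suc)
  ultimately show ?thesis
    using demand_le[OF \<open>P \<ge> 1\<close>, of l] by (simp add: g_demand_def algebra_simps sum_distrib_left)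
qed

lemma g_demand_indicator_ge:
  assumes "P \<ge> 1" "l \<ge> 1"
  shows "g_demand m P l (indicator I) \<ge> - (real l * P ^ (l - 1))"
proof -
  have "- real l * P ^ (l - 1) \<le>
      (P * (\<Sum>j=1..m. indicator I (var_index m l j)) - real l) * P ^ (l - 1)"
    using \<open>P \<ge> 1\<close> by (intro mult_right_mono) (simp_all add: sum_nonneg)
  also have "\<dots> \<le> g_demand m P l (indicator I)"
    using assms by (intro g_demand_ge) auto
  finally show ?thesis by simp
qed

lemma g_demand_indicator_ge_meeting:
  assumes "P \<ge> 1" "l \<ge> 1" "j \<in> {1..m}" "var_index m l j \<in> I"
  shows "g_demand m P l (indicator I) \<ge> (P - real l) * P ^ (l - 1)"
proof -
  have "1 \<le> (\<Sum>j=1..m. indicator I (var_index m l j) :: real)"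
    using assms(3,4) member_le_sum[of j "{1..m}" "\<lambda>j. indicator I (var_index m l j) :: real"] by simp
  then have "P * 1 \<le> P * (\<Sum>j=1..m. indicator I (var_index m l j))"
    using \<open>P \<ge> 1\<close> by (intro mult_left_mono) auto
  then have "(P - real l) * P ^ (l - 1) \<le>
      (P * (\<Sum>j=1..m. indicator I (var_index m l j)) - real l) * P ^ (l - 1)"
    using \<open>P \<ge> 1\<close> by (intro mult_right_mono) auto
  also have "\<dots> \<le> g_demand m P l (indicator I)"
    using assms by (intro g_demand_ge) auto
  finally show ?thesis .
qed

lemma psd_on_zeta_matrix_g_demand:
  assumes "t < m" "l \<in> {1..m}" "\<alpha> \<ge> 0" and P_ge: "P \<ge> (1 + 2 ^ (m\<^sup>2 + (t + 1))) * real l"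
  shows "psd_on (subsets_upto t (m\<^sup>2))
    (zeta_matrix (m\<^sup>2) (\<lambda>I. g_demand m P l (indicator I) * y_vec (m\<^sup>2) t \<alpha> I))"
proof -
  let ?C = "2 ^ (m\<^sup>2 + (t + 1)) :: real" and ?B = "var_index m l ` {1..t + 1}"
  have "l \<ge> 1" using assms by simp
  then have "1 * 1 \<le> (1 + ?C) * real l"
    by (intro mult_mono) auto
  with P_ge have "P \<ge> 1" by simp
  show ?thesis
  proof (rule psd_on_zeta_matrix_y_vec_dominated)
    show "?B \<subseteq> {1..m\<^sup>2}"
      using assms var_index_in_atLeastAtMost[of l m _ m] by (force simp: power2_eq_square)
    show "card ?B = t + 1"
      by (simp add: card_image inj_on_subset[OF inj_var_index])
    show "0 \<le> real l * P ^ (l - 1)" using \<open>P \<ge> 1\<close> by simp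
    fix I
    show "- (real l * P ^ (l - 1)) \<le> g_demand m P l (indicator I)"
      using \<open>P \<ge> 1\<close> \<open>l \<ge> 1\<close> by (rule g_demand_indicator_ge)
    assume "I \<inter> ?B \<noteq> {}"
    then obtain j where "j \<in> {1..m}" "var_index m l j \<in> I"
      using \<open>t < m\<close> by force
    have "?C * (real l * P ^ (l - 1)) \<le> (P - real l) * P ^ (l - 1)"
      unfolding mult.assoc[symmetric]
      using P_ge \<open>P \<ge> 1\<close> by (intro mult_right_mono) (auto simp: algebra_simps)
    also have "\<dots> \<le> g_demand m P l (indicator I)"
      using \<open>P \<ge> 1\<close> \<open>l \<ge> 1\<close> \<open>j \<in> {1..m}\<close> \<open>var_index m l j \<in> I\<close>
      by (rule g_demand_indicator_ge_meeting)
    finally show "?C * (real l * P ^ (l - 1)) \<le> g_demand m P l (indicator I)" .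
  qed (rule \<open>\<alpha> \<ge> 0\<close>)
qed

lemma psd_on_zeta_matrix_g_cost:
  assumes "T \<ge> real t + 1" "\<alpha> \<ge> 0"
  shows "psd_on S (zeta_matrix (m\<^sup>2) (\<lambda>I. g_cost m T (indicator I) * y_vec (m\<^sup>2) t \<alpha> I))"
  using assms by (intro psd_on_zeta_matrix_nonneg) (auto simp: y_vec_def g_cost_indicator)

lemma y_vec_in_Las_LP:
  assumes "t < m" "T \<ge> real t + 1" "\<alpha> \<ge> 0"
    and P_ge: "P \<ge> (1 + 2 ^ (m\<^sup>2 + (t + 1))) * real m"
    and "(\<Sum>I\<in>Pow {1..m\<^sup>2}. y_vec (m\<^sup>2) t \<alpha> I) = 1"
  shows "y_vec (m\<^sup>2) t \<alpha> \<in> Las (m\<^sup>2) t (LP m P T)"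
proof -
  let ?psd_localized = "\<lambda>g. psd_on (subsets_upto t (m\<^sup>2))
    (zeta_matrix (m\<^sup>2) (\<lambda>I. g (indicator I) * y_vec (m\<^sup>2) t \<alpha> I))"
  have "psd_on (subsets_upto (t + 1) (m\<^sup>2)) (zeta_matrix (m\<^sup>2) (y_vec (m\<^sup>2) t \<alpha>))"
    using \<open>\<alpha> \<ge> 0\<close> by (intro psd_on_zeta_matrix_nonneg) (simp add: y_vec_def)
  moreover have "?psd_localized (g_cost m T)"
    using assms(2,3) by (rule psd_on_zeta_matrix_g_cost)
  moreover have "?psd_localized (g_demand m P l)" if "l \<in> {1..m}" for l
  proof (rule psd_on_zeta_matrix_g_demand[OF \<open>t < m\<close> that \<open>\<alpha> \<ge> 0\<close>])
    show "(1 + 2 ^ (m\<^sup>2 + (t + 1))) * real l \<le> P"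
      using that by (intro order_trans[OF _ P_ge] mult_left_mono) auto
  qed
  ultimately show ?thesis
    using assms(5) by (auto simp: Las_def LP_def)
qed

theorem theorem2:
  fixes k m n t :: nat and T \<alpha> :: real
  assumes "k \<ge> 1"
    and "m \<ge> 1"
    and "n = m ^ 2"
    and "real t = sqrt (real n) / real k - 1"
    and "T = sqrt (real n) / real k"
    and "\<alpha> > 0"
    and "(\<Sum>I\<in>Pow {1..n}. y_vec n t \<alpha> I) = 1"
  shows "\<exists>P\<^sub>0>1. \<forall>P::real. P \<ge> P\<^sub>0 \<longrightarrow> y_vec n t \<alpha> \<in> Las n t (LP m P T)"
proof (intro exI conjI allI impI)
  let ?P\<^sub>0 = "(1 + 2 ^ (m\<^sup>2 + (t + 1))) * real m"
  have "1 * 1 < ?P\<^sub>0"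
    using \<open>m \<ge> 1\<close> by (intro mult_less_le_imp_less) auto
  then show "1 < ?P\<^sub>0" by simp
  have "T = real t + 1" and "T = real m / real k"
    using assms by simp_all
  moreover have "real m / real k \<le> real m"
    using \<open>k \<ge> 1\<close> divide_left_mono[of 1 "real k" "real m"] by simp
  ultimately have "t < m" by linarith
  fix P assume "?P\<^sub>0 \<le> P"
  then show "y_vec n t \<alpha> \<in> Las n t (LP m P T)"
    using y_vec_in_Las_LP \<open>t < m\<close> \<open>T = real t + 1\<close> assms(3,6,7) by simp
qed

end
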